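(* Let $A_2(n;k,\ell,m)$ be the number of finite sequences $\lambda_1,\dots,\lambda_s$ of coloured positive integers with $\sum\lambda_i=n$, where odd parts are coloured $a$ or $d$, even parts are coloured $b$ or $c$, there is no part $1_d$, and $\lambda_i-\lambda_{i+1}\ge B_2(\text{colour of }\lambda_i,\text{colour of }\lambda_{i+1})$ for all $1\le i<s$, having $k$ parts coloured $a$, $\ell$ parts coloured $c$ and $m$ parts coloured $d$. Then $$\sum_{n,k,\ell,m\ge0}A_2(n;k,\ell,m)\,q^n a^k c^\ell d^m=\frac{(-aq;q^4)_\infty(-dq^3;q^4)_\infty}{(q^2;q^2)_\infty(cq^2;q^4)_\infty}.$$ In particular (setting $a=c=d=1$) the generating function of all such coloured partitions is $1/(q;q)_\infty$.
   Context: Notation: $(x;q)_\infty=\prod_{n\ge0}(1-xq^n)$. $B_2$ is the matrix with rows and columns indexed by $(a,b,c,d)$: row $a$: $(4,1,3,2)$; row $b$: $(3,0,2,1)$; row $c$: $(1,2,0,3)$; row $d$: $(2,3,1,4)$. *)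

theory Defs
  imports "HOL-Computational_Algebra.Formal_Power_Series"
begin

datatype colour = Ca | Cb | Cc | Cd

fun B2 :: "colour \<Rightarrow> colour \<Rightarrow> int" where
  "B2 Ca Ca = 4" | "B2 Ca Cb = 1" | "B2 Ca Cc = 3" | "B2 Ca Cd = 2"
| "B2 Cb Ca = 3" | "B2 Cb Cb = 0" | "B2 Cb Cc = 2" | "B2 Cb Cd = 1"
| "B2 Cc Ca = 1" | "B2 Cc Cb = 2" | "B2 Cc Cc = 0" | "B2 Cc Cd = 3"
| "B2 Cd Ca = 2" | "B2 Cd Cb = 3" | "B2 Cd Cc = 1" | "B2 Cd Cd = 4"

definition valid_part :: "nat \<times> colour \<Rightarrow> bool" where
  "valid_part p \<longleftrightarrow> fst p > 0 \<and>
     (odd (fst p) \<longrightarrow> snd p \<in> {Ca, Cd}) \<and>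
     (even (fst p) \<longrightarrow> snd p \<in> {Cb, Cc}) \<and>
     p \<noteq> (1, Cd)"

definition valid_seq :: "(nat \<times> colour) list \<Rightarrow> bool" where
  "valid_seq xs \<longleftrightarrow> (\<forall>p \<in> set xs. valid_part p) \<and>
     (\<forall>i. i + 1 < length xs \<longrightarrow>
        int (fst (xs ! i)) - int (fst (xs ! (i+1))) \<ge> B2 (snd (xs ! i)) (snd (xs ! (i+1))))"

definition ncol :: "colour \<Rightarrow> (nat \<times> colour) list \<Rightarrow> nat" where
  "ncol c xs = length (filter (\<lambda>p. snd p = c) xs)"

definition A2 :: "nat \<Rightarrow> nat \<Rightarrow> nat \<Rightarrow> nat \<Rightarrow> nat" where
  "A2 n k l m = card {xs. valid_seq xs \<and> sum_list (map fst xs) = n \<and>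
      ncol Ca xs = k \<and> ncol Cc xs = l \<and> ncol Cd xs = m}"

text \<open>The q-Pochhammer symbol (x q^r; q^k)_\<infinity> as a formal power series in q
  (meaningful for r, k \<ge> 1): the coefficient of q^n is that of the finite product
  over j \<le> n, since the remaining factors are 1 + O(q^(n+1)).\<close>
definition qpoch :: "'a::comm_ring_1 \<Rightarrow> nat \<Rightarrow> nat \<Rightarrow> 'a fps" where
  "qpoch x r k = Abs_fps (\<lambda>n. fps_nth ((\<Prod>j\<le>n. 1 - fps_const x * fps_X ^ (r + k * j))) n)"

end

theory Submission
  imports Defs
begin

text \<open>
  Group the parts into levels, level \<open>k\<close> consisting of \<open>2k - 1\<close> coloured \<open>a\<close>, \<open>2k\<close> coloured \<open>b\<close>
  or \<open>c\<close>, and \<open>2k + 1\<close> coloured \<open>d\<close>. Let \<open>P\<^sub>k\<close> be the generating function of the sequences whose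
  first part is of level below \<open>k\<close> or is \<open>2k\<close> coloured \<open>b\<close>. Removing the first part yields a
  linear system for several such families, and eliminating all but \<open>P\<^sub>k\<close> leaves a four-term recurrence,
  that is, a second order q-difference equation for \<open>F(x) = \<Sum> P\<^sub>k x\<^sup>k\<close>. It is solved by
  \<open>F(x) = (-x; q\<^sup>2)\<^sub>\<infinity> \<Sum> \<chi>\<^sub>n x\<^sup>2\<^sup>n\<close> with
  \<open>\<chi>\<^sub>n = (-aq; q\<^sup>4)\<^sub>n (-dq\<^sup>3; q\<^sup>4)\<^sub>n / ((q\<^sup>4; q\<^sup>4)\<^sub>n (cq\<^sup>2; q\<^sup>4)\<^sub>n)\<close>.
  The generating function sought is the limit of \<open>P\<^sub>k\<close>. Writing
  \<open>F(x) = (-xq\<^sup>2; q\<^sup>2)\<^sub>\<infinity> \<cdot> (1 + x) \<Sum> \<chi>\<^sub>n x\<^sup>2\<^sup>n\<close>, whose second factor has coefficients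
  \<open>\<chi>\<^bsub>k div 2\<^esub>\<close>, this limit is \<open>(-q\<^sup>2; q\<^sup>2)\<^sub>\<infinity> \<chi>\<^sub>\<infinity>\<close>, in every characteristic.
\<close>

unbundle fps_syntax

section \<open>Coefficientwise limits of formal power series\<close>

lemma tendsto_fps_mult:
  fixes F G :: "'b \<Rightarrow> 'a::comm_ring_1 fps"
  assumes "(F \<longlongrightarrow> L) A" "(G \<longlongrightarrow> M) A"
  shows "((\<lambda>k. F k * G k) \<longlongrightarrow> L * M) A"
proof (rule tendsto_fpsI)
  fix n
  have "\<forall>\<^sub>F k in A. \<forall>i\<in>{..n}. F k $ i = L $ i" "\<forall>\<^sub>F k in A. \<forall>i\<in>{..n}. G k $ i = M $ i"
    using assms by (auto simp: tendsto_fps_iff intro!: eventually_ball_finite)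
  then show "\<forall>\<^sub>F k in A. (F k * G k) $ n = (L * M) $ n"
    by eventually_elim (simp add: fps_mult_nth)
qed

lemma tendsto_fps_add:
  fixes F G :: "'b \<Rightarrow> 'a::comm_ring_1 fps"
  assumes "(F \<longlongrightarrow> L) A" "(G \<longlongrightarrow> M) A"
  shows "((\<lambda>k. F k + G k) \<longlongrightarrow> L + M) A"
proof (rule tendsto_fpsI)
  fix n
  have "\<forall>\<^sub>F k in A. F k $ n = L $ n" "\<forall>\<^sub>F k in A. G k $ n = M $ n"
    using assms by (auto simp: tendsto_fps_iff)
  then show "\<forall>\<^sub>F k in A. (F k + G k) $ n = (L + M) $ n"
    by eventually_elim simp
qed

text \<open>Coefficient \<open>n\<close> is frozen from index \<open>n\<close> on, so the limit is
  read off the diagonal; \<open>qpoch\<close>, \<open>euler_sum\<close> and the limit of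
  \<open>chi\<close> all have this form.\<close>

lemma tendsto_fps_stabilize:
  fixes F :: "nat \<Rightarrow> 'a::comm_ring_1 fps"
  assumes "\<And>k n. n \<le> k \<Longrightarrow> F (Suc k) $ n = F k $ n"
  shows "F \<longlonglongrightarrow> Abs_fps (\<lambda>n. F n $ n)"
proof (rule tendsto_fpsI)
  fix n
  have "F k $ n = F n $ n" if "n \<le> k" for k
    using that by (induction k rule: dec_induct) (simp_all add: assms)
  then show "\<forall>\<^sub>F k in sequentially. F k $ n = Abs_fps (\<lambda>n. F n $ n) $ n"
    unfolding fps_nth_Abs_fps eventually_at_top_linorder by blast
qed

lemma fps_sum_stable_nth:
  fixes u :: "nat \<Rightarrow> 'a::comm_ring_1 fps"
  assumes "\<And>i j. i < j \<Longrightarrow> u j $ i = 0" "n \<le> k"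
  shows "(\<Sum>j\<le>k. u j) $ n = (\<Sum>j\<le>n. u j) $ n"
  unfolding fps_sum_nth by (rule sum.mono_neutral_right) (use assms in auto)

text \<open>An Abel-type statement: if \<open>u\<close> and \<open>v\<close> list the coefficients
  of \<open>U(x)\<close> and \<open>W(x)\<close>, those of the product tend to \<open>U(1)\<close>
  times the limit of \<open>v\<close>. Since \<open>u j\<close> has order at least \<open>j\<close>
  in \<open>q\<close>, \<open>U(1)\<close> exists and only \<open>j \<le> n\<close> affect
  coefficient \<open>n\<close>.\<close>

lemma tendsto_fps_convolution:
  fixes u v :: "nat \<Rightarrow> 'a::comm_ring_1 fps"
  assumes u: "\<And>i j. i < j \<Longrightarrow> u j $ i = 0" and v: "v \<longlonglongrightarrow> V"
  shows "(\<lambda>k. \<Sum>j\<le>k. u j * v (k - j)) \<longlonglongrightarrow> Abs_fps (\<lambda>n. (\<Sum>j\<le>n. u j) $ n) * V"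
proof (rule tendsto_fpsI)
  fix n
  have "\<forall>\<^sub>F k in sequentially. \<forall>i\<in>{..n}. v k $ i = V $ i"
    using v by (auto simp: tendsto_fps_iff intro!: eventually_ball_finite)
  then obtain K where K: "v k $ i = V $ i" if "k \<ge> K" "i \<le> n" for i k
    by (auto simp: eventually_at_top_linorder)
  show "\<forall>\<^sub>F k in sequentially. (\<Sum>j\<le>k. u j * v (k - j)) $ n =
      (Abs_fps (\<lambda>n. (\<Sum>j\<le>n. u j) $ n) * V) $ n"
    \<comment> \<open>From here on \<open>k - j \<ge> K\<close> for every relevant
      \<open>j \<le> n\<close>.\<close>
    using eventually_ge_at_top[of "K + n"]
  proof eventually_elim
    case (elim k)
    have "(\<Sum>j\<le>k. u j * v (k - j)) $ n = (\<Sum>j\<le>n. (u j * v (k - j)) $ n)"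
      unfolding fps_sum_nth
      by (rule sum.mono_neutral_right) (use elim u in \<open>auto simp: fps_mult_nth\<close>)
    also have "\<dots> = (\<Sum>j\<le>n. (u j * V) $ n)"
      by (intro sum.cong refl) (use elim K in \<open>simp add: fps_mult_nth\<close>)
    also have "\<dots> = ((\<Sum>j\<le>n. u j) * V) $ n"
      by (simp add: sum_distrib_right fps_sum_nth)
    also have "\<dots> = (Abs_fps (\<lambda>n. (\<Sum>j\<le>n. u j) $ n) * V) $ n"
      unfolding fps_mult_nth fps_nth_Abs_fps
      by (intro sum.cong refl arg_cong2[of _ _ _ _ times] fps_sum_stable_nth u) auto
    finally show ?case .
  qed
qed

section \<open>Infinite q-products\<close>

lemma mult_one_minus_X_power_nth:
  fixes F :: "'a::comm_ring_1 fps"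
  assumes "n < m"
  shows "(F * (1 - fps_const x * fps_X ^ m)) $ n = F $ n"
proof -
  have "F * (1 - fps_const x * fps_X ^ m) = F - fps_X ^ m * (fps_const x * F)"
    by (simp add: algebra_simps)
  then show ?thesis using assms by (simp add: fps_X_power_mult_nth)
qed

lemma one_minus_X_power_nonzero: "m > 0 \<Longrightarrow> 1 - fps_const x * fps_X ^ m \<noteq> (0 :: 'a::field fps)"
proof
  assume "m > 0" and *: "1 - fps_const x * fps_X ^ m = (0 :: 'a fps)"
  then show False using mult_one_minus_X_power_nth[of 0 m 1 x] unfolding * by simp
qed

lemma qpoch_tendsto:
  fixes x :: "'a::comm_ring_1"
  assumes "r > 0" "k > 0"
  shows "(\<lambda>N. \<Prod>j<N. 1 - fps_const x * fps_X ^ (r + k * j)) \<longlonglongrightarrow> qpoch x r k"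
proof -
  have "(\<lambda>N. \<Prod>j<Suc N. 1 - fps_const x * fps_X ^ (r + k * j)) \<longlonglongrightarrow> qpoch x r k"
    unfolding qpoch_def lessThan_Suc_atMost
  proof (rule tendsto_fps_stabilize)
    fix N n :: nat
    assume "n \<le> N"
    then have "n < 1 * Suc N" by simp
    also have "\<dots> \<le> k * Suc N" using assms by (intro mult_le_mono1) simp
    also have "\<dots> \<le> r + k * Suc N" by simp
    finally show "(\<Prod>j\<le>Suc N. 1 - fps_const x * fps_X ^ (r + k * j)) $ n
       = (\<Prod>j\<le>N. 1 - fps_const x * fps_X ^ (r + k * j)) $ n"
      by (simp only: prod.atMost_Suc mult_one_minus_X_power_nth)
  qed
  then show ?thesis by (rule LIMSEQ_imp_Suc)
qed

lemma qpoch_nonzero: "r > 0 \<Longrightarrow> qpoch x r k \<noteq> 0"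
proof -
  assume "r > 0"
  then have "qpoch x r k $ 0 = 1" by (simp add: qpoch_def)
  then show ?thesis by auto
qed

lemma prod_lessThan_double:
  fixes f :: "nat \<Rightarrow> 'b::comm_monoid_mult"
  shows "(\<Prod>j<2 * N. f j) = (\<Prod>j<N. f (2 * j)) * (\<Prod>j<N. f (2 * j + 1))"
  by (induction N) (simp_all add: mult_ac)

text \<open>Factors of even and odd index are separated; the left product is followed along the
  bounds \<open>2 * N\<close> only, which does not change its limit.\<close>

lemma qpoch_dissect:
  fixes x :: "'a::comm_ring_1"
  assumes "r > 0" "k > 0"
  shows "qpoch x r k = qpoch x r (2 * k) * qpoch x (r + k) (2 * k)"
proof (rule LIMSEQ_unique)
  have "filterlim (\<lambda>N::nat. 2 * N) sequentially sequentially"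
    by (rule filterlim_subseq) (simp add: strict_mono_def)
  from filterlim_compose[OF qpoch_tendsto[OF assms, of x] this]
  show "(\<lambda>N. \<Prod>j<2 * N. 1 - fps_const x * fps_X ^ (r + k * j)) \<longlonglongrightarrow> qpoch x r k" .
  have "(\<Prod>j<2 * N. 1 - fps_const x * fps_X ^ (r + k * j)) =
      (\<Prod>j<N. 1 - fps_const x * fps_X ^ (r + 2 * k * j))
      * (\<Prod>j<N. 1 - fps_const x * fps_X ^ (r + k + 2 * k * j))" for N
    unfolding prod_lessThan_double by (simp add: algebra_simps)
  then show "(\<lambda>N. \<Prod>j<2 * N. 1 - fps_const x * fps_X ^ (r + k * j))
      \<longlonglongrightarrow> qpoch x r (2 * k) * qpoch x (r + k) (2 * k)"
    using tendsto_fps_mult[OF qpoch_tendsto[of r "2 * k" x] qpoch_tendsto[of "r + k" "2 * k" x]] assms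
    by simp
qed

text \<open>Factorwise this is \<open>(1 + y) * (1 - y) = 1 - y ^ 2\<close>.\<close>

lemma qpoch_uminus_mult:
  fixes x :: "'a::comm_ring_1"
  assumes "r > 0" "k > 0"
  shows "qpoch (- x) r k * qpoch x r k = qpoch (x\<^sup>2) (2 * r) (2 * k)"
proof (rule LIMSEQ_unique)
  show "(\<lambda>N. (\<Prod>j<N. 1 - fps_const (- x) * fps_X ^ (r + k * j))
       * (\<Prod>j<N. 1 - fps_const x * fps_X ^ (r + k * j))) \<longlonglongrightarrow> qpoch (- x) r k * qpoch x r k"
    by (intro tendsto_fps_mult qpoch_tendsto assms)
  have "(1 - fps_const (- x) * fps_X ^ m) * (1 - fps_const x * fps_X ^ m)
      = 1 - fps_const (x\<^sup>2) * fps_X ^ (2 * m)" for m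
  proof -
    have "fps_const (- x) = - fps_const x" "fps_const (x\<^sup>2) = fps_const x * fps_const x"
      by (simp_all add: power2_eq_square)
    then show ?thesis
      by (simp only: mult_2 power_add) (simp only: algebra_simps minus_mult_left[symmetric], simp)
  qed
  then have "(\<Prod>j<N. 1 - fps_const (- x) * fps_X ^ (r + k * j))
       * (\<Prod>j<N. 1 - fps_const x * fps_X ^ (r + k * j))
     = (\<Prod>j<N. 1 - fps_const (x\<^sup>2) * fps_X ^ (2 * r + 2 * k * j))" for N
    by (simp only: prod.distrib[symmetric] distrib_left mult.assoc)
  then show "(\<lambda>N. (\<Prod>j<N. 1 - fps_const (- x) * fps_X ^ (r + k * j))
       * (\<Prod>j<N. 1 - fps_const x * fps_X ^ (r + k * j))) \<longlonglongrightarrow> qpoch (x\<^sup>2) (2 * r) (2 * k)"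
    using qpoch_tendsto[of "2 * r" "2 * k" "x\<^sup>2"] assms by simp
qed

section \<open>Euler's expansion of \<open>E(x) = (-x; q^2)_inf\<close>\<close>

text \<open>\<open>euler j\<close> is the coefficient of \<open>x ^ j\<close> in \<open>(-x; q\<^sup>2)\<^sub>\<infinity>\<close>.\<close>
primrec euler :: "nat \<Rightarrow> 'a::field fps" where
  "euler 0 = 1"
| "euler (Suc j) = fps_X ^ (2 * j) * euler j * inverse (1 - fps_X ^ (2 * j + 2))"

text \<open>The coefficient of \<open>x ^ (j + 1)\<close> in
  \<open>E(x) = (1 + x) * E(q^2 * x)\<close>.\<close>

lemma euler_Suc_eq:
  "euler (Suc j) = fps_X ^ (2 * j + 2) * euler (Suc j) + fps_X ^ (2 * j) * (euler j :: 'a::field fps)"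
proof -
  have "(1 - fps_X ^ (2 * j + 2)) * inverse (1 - fps_X ^ (2 * j + 2)) = (1 :: 'a fps)"
    by (subst mult.commute, rule inverse_mult_eq_1) simp
  then have "(1 - fps_X ^ (2 * j + 2)) * euler (Suc j) = fps_X ^ (2 * j) * (euler j :: 'a fps)"
    by (simp add: mult_ac)
  then show ?thesis by (simp only: left_diff_distrib mult_1 diff_eq_eq add.commute)
qed

text \<open>The value of \<open>E(x)\<close> at \<open>x = q ^ (2 * N)\<close>. For
  \<open>N > 0\<close> the term of index \<open>j\<close> has order at least \<open>j\<close>, so
  the terms up to \<open>n\<close> fix coefficient \<open>n\<close>.\<close>

definition euler_sum :: "nat \<Rightarrow> 'a::field fps" where
  "euler_sum N = Abs_fps (\<lambda>n. (\<Sum>j\<le>n. fps_X ^ (2 * N * j) * euler j) $ n)"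

lemma euler_term_nth:
  assumes "N > 0" "n < j"
  shows "(fps_X ^ (2 * N * j) * euler j) $ n = 0"
proof -
  have "1 * j \<le> 2 * N * j" using assms by (intro mult_le_mono1) simp
  then have "n < 2 * N * j" using assms by linarith
  then show ?thesis by (simp only: fps_X_power_mult_nth if_True)
qed

lemma euler_sum_tendsto:
  assumes "N > 0"
  shows "(\<lambda>K. \<Sum>j\<le>K. fps_X ^ (2 * N * j) * euler j) \<longlonglongrightarrow> euler_sum N"
  unfolding euler_sum_def
  by (rule tendsto_fps_stabilize)
     (simp only: sum.atMost_Suc fps_add_nth euler_term_nth[OF assms] less_Suc_eq_le add_0_right)

text \<open>This is \<open>E(x) = (1 + x) * E(q^2 * x)\<close> at \<open>x = q ^ (2 * N)\<close>,
  with \<open>1 + x\<close> in the shape of a factor of \<open>qpoch (- 1) 2 2\<close>.\<close>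

lemma euler_sum_Suc:
  assumes "N > 0"
  shows "euler_sum N = euler_sum (Suc N) * (1 - fps_const (- 1) * fps_X ^ (2 * N) :: 'a::field fps)"
proof (rule LIMSEQ_unique)
  define s where "s N K = (\<Sum>j\<le>K. fps_X ^ (2 * N * j) * euler j :: 'a fps)" for N K
  have s_tendsto: "s N \<longlonglongrightarrow> euler_sum N" if "N > 0" for N
    using euler_sum_tendsto[OF that] unfolding s_def .
  show "(\<lambda>K. s N (Suc K)) \<longlonglongrightarrow> euler_sum N"
    using s_tendsto[OF assms] by (rule LIMSEQ_Suc)
  have "fps_X ^ (2 * N * Suc j) * euler (Suc j) =
      fps_X ^ (2 * Suc N * Suc j) * euler (Suc j)
      + fps_X ^ (2 * N) * (fps_X ^ (2 * Suc N * j) * euler j :: 'a fps)" for j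
    by (subst euler_Suc_eq) (simp add: algebra_simps power_add del: euler.simps)
  then have step: "s N (Suc K) = s (Suc N) (Suc K) + fps_X ^ (2 * N) * s (Suc N) K" for K
    unfolding s_def sum.atMost_Suc_shift[of _ K]
    by (simp only: sum.distrib sum_distrib_left) simp
  have "(\<lambda>K. s (Suc N) (Suc K) + fps_X ^ (2 * N) * s (Suc N) K)
      \<longlonglongrightarrow> euler_sum (Suc N) + fps_X ^ (2 * N) * euler_sum (Suc N)"
    by (intro tendsto_fps_add tendsto_fps_mult tendsto_const s_tendsto LIMSEQ_Suc) simp_all
  moreover have "fps_const (- 1 :: 'a) = - 1" by (simp flip: fps_const_neg)
  ultimately show "(\<lambda>K. s N (Suc K)) \<longlonglongrightarrow>
      euler_sum (Suc N) * (1 - fps_const (- 1) * fps_X ^ (2 * N))"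
    unfolding step by (simp add: algebra_simps)
qed

text \<open>Iterating the functional equation \<open>M\<close> times splits off the first
  \<open>M\<close> factors of the product; the remaining value \<open>euler_sum (Suc M)\<close>
  tends to its term \<open>j = 0\<close>, which is 1.\<close>

lemma euler_sum_1: "euler_sum 1 = (qpoch (- 1) 2 2 :: 'a::field fps)"
proof (rule LIMSEQ_unique)
  have eq: "(euler_sum 1 :: 'a fps) = (\<Prod>j<M. 1 - fps_const (- 1) * fps_X ^ (2 + 2 * j)) * euler_sum (Suc M)" for M
  proof (induction M)
    case (Suc M)
    show ?case
      by (subst Suc.IH, subst euler_sum_Suc[of "Suc M"]) (simp_all add: mult_ac)
  qed simp
  show "(\<lambda>M. (\<Prod>j<M. 1 - fps_const (- 1) * fps_X ^ (2 + 2 * j)) * euler_sum (Suc M))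
      \<longlonglongrightarrow> (euler_sum 1 :: 'a fps)"
    unfolding eq[symmetric] by (rule tendsto_const)
  have "(\<lambda>M. euler_sum (Suc M)) \<longlonglongrightarrow> (1 :: 'a fps)"
  proof (rule tendsto_fpsI)
    fix n
    show "\<forall>\<^sub>F M in sequentially. euler_sum (Suc M) $ n = (1 :: 'a fps) $ n"
      using eventually_ge_at_top[of n]
    proof eventually_elim
      case (elim M)
      have "(fps_X ^ (2 * Suc M * j) * euler j) $ n = (0 :: 'a)" if "j > 0" for j
      proof -
        have "n < 2 * Suc M * 1" using elim by simp
        also have "\<dots> \<le> 2 * Suc M * j" using that by (intro mult_le_mono2) simp
        finally show ?thesis by (simp only: fps_X_power_mult_nth if_True)
      qed
      then have "(\<Sum>j\<le>n. (fps_X ^ (2 * Suc M * j) * euler j) $ n :: 'a) =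
          (\<Sum>j\<in>{0}. (fps_X ^ (2 * Suc M * j) * euler j) $ n)"
        by (intro sum.mono_neutral_right) auto
      then show ?case by (simp add: euler_sum_def fps_sum_nth)
    qed
  qed
  from tendsto_fps_mult[OF qpoch_tendsto[of 2 2 "- 1"] this]
  show "(\<lambda>M. (\<Prod>j<M. 1 - fps_const (- 1) * fps_X ^ (2 + 2 * j)) * euler_sum (Suc M))
      \<longlonglongrightarrow> (qpoch (- 1) 2 2 :: 'a fps)"
    by simp
qed

section \<open>Valid sequences: recursion and finiteness\<close>

lemma valid_seq_Nil [simp]: "valid_seq []"
  by (simp add: valid_seq_def)

lemma valid_seq_Cons:
  "valid_seq (p # xs) \<longleftrightarrow> valid_part p \<and> valid_seq xs \<and>
     (xs = [] \<or> int (fst p) - int (fst (hd xs)) \<ge> B2 (snd p) (snd (hd xs)))"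
  (is "?l \<longleftrightarrow> ?r")
proof
  assume l: ?l
  have "int (fst (xs ! i)) - int (fst (xs ! (i+1))) \<ge> B2 (snd (xs ! i)) (snd (xs ! (i+1)))"
    if "i + 1 < length xs" for i
    using l that unfolding valid_seq_def by (auto dest: spec[of _ "Suc i"])
  moreover have "xs = [] \<or> int (fst p) - int (fst (hd xs)) \<ge> B2 (snd p) (snd (hd xs))"
    using l unfolding valid_seq_def by (cases xs) (auto dest: spec[of _ 0])
  ultimately show ?r using l unfolding valid_seq_def by auto
next
  assume r: ?r
  show ?l unfolding valid_seq_def
  proof (intro conjI allI impI)
    show "\<forall>q\<in>set (p # xs). valid_part q" using r by (auto simp: valid_seq_def)
    fix i assume i: "i + 1 < length (p # xs)"
    show "B2 (snd ((p # xs) ! i)) (snd ((p # xs) ! (i+1)))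
        \<le> int (fst ((p # xs) ! i)) - int (fst ((p # xs) ! (i+1)))"
      using r i by (cases i; cases xs) (auto simp: valid_seq_def)
  qed
qed

lemma finite_positive_lists_sum:
  "finite {xs :: (nat \<times> colour) list. (\<forall>p\<in>set xs. fst p > 0) \<and> sum_list (map fst xs) = n}"
proof -
  have UNIV_colour: "(UNIV :: colour set) = {Ca, Cb, Cc, Cd}"
    using colour.exhaust by auto
  have "length xs \<le> n \<and> set xs \<subseteq> {..n} \<times> UNIV"
    if "\<forall>p\<in>set xs. fst p > 0" "sum_list (map fst xs) = n" for xs :: "(nat \<times> colour) list"
    using that
  proof (induction xs arbitrary: n)
    case (Cons p xs)
    have "length xs \<le> sum_list (map fst xs)" "set xs \<subseteq> {..sum_list (map fst xs)} \<times> UNIV"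
      using Cons.IH[OF _ refl] Cons.prems by auto
    moreover have "fst p > 0" "n = fst p + sum_list (map fst xs)"
      using Cons.prems by auto
    ultimately show ?case by (cases p) fastforce
  qed simp
  then have "{xs :: (nat \<times> colour) list. (\<forall>p\<in>set xs. fst p > 0) \<and> sum_list (map fst xs) = n}
      \<subseteq> {xs. set xs \<subseteq> {..n} \<times> UNIV \<and> length xs \<le> n}"
    by auto
  moreover have "finite ({..n} \<times> (UNIV :: colour set))"
    by (simp add: UNIV_colour)
  ultimately show ?thesis
    using finite_lists_length_le finite_subset by blast
qed

lemma finite_valid_seq_sum: "finite {xs. valid_seq xs \<and> sum_list (map fst xs) = n}"
  by (rule finite_subset[OF _ finite_positive_lists_sum[of n]])
     (auto simp: valid_seq_def valid_part_def)

section \<open>Levels and the parts that may follow a given part\<close>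

definition successors :: "nat \<times> colour \<Rightarrow> (nat \<times> colour) set" where
  "successors p = {r. valid_part r \<and> int (fst p) - int (fst r) \<ge> B2 (snd p) (snd r)}"

text \<open>A part coloured \<open>e\<close> of level \<open>k\<close> has size \<open>2 * k + offset e\<close>. In terms of levels the difference
  conditions are those of Primc, with entries in \<open>{0, 1, 2}\<close>.\<close>
fun offset :: "colour \<Rightarrow> int" where
  "offset Ca = -1" | "offset Cb = 0" | "offset Cc = 0" | "offset Cd = 1"

text \<open>The parts of level at most \<open>k\<close>. Level 0 is empty: its parts coloured
  \<open>a\<close>, \<open>b\<close>, \<open>c\<close> would not be positive, and its part coloured
  \<open>d\<close> is the forbidden \<open>(1, Cd)\<close>.\<close>

definition below :: "nat \<Rightarrow> (nat \<times> colour) set" where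
  "below k = {r. valid_part r \<and> int (fst r) \<le> 2 * int k + offset (snd r)}"

lemma successors_Ca:
  "successors (2 * Suc k + 1, Ca) = insert (2 * Suc k, Cb) (below k)"
proof -
  have "r \<in> successors (2 * Suc k + 1, Ca) \<longleftrightarrow> r \<in> insert (2 * Suc k, Cb) (below k)" for r
    by (cases r; cases "snd r"; simp add: successors_def below_def valid_part_def; presburger)
  then show ?thesis by blast
qed

text \<open>Row \<open>a\<close> of \<open>B2\<close> exceeds row \<open>b\<close> by 1 in every
  column, which compensates the difference in size.\<close>

lemma successors_Cb: "successors (2 * Suc k, Cb) = successors (2 * Suc k + 1, Ca)"
proof -
  have "r \<in> successors (2 * Suc k, Cb) \<longleftrightarrow> r \<in> successors (2 * Suc k + 1, Ca)" for r
    by (cases r; cases "snd r"; simp add: successors_def valid_part_def; presburger)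
  then show ?thesis by blast
qed

text \<open>Likewise row \<open>d\<close> of \<open>B2\<close> exceeds row \<open>c\<close> by 1 in
  every column.\<close>

lemma successors_Cc: "successors (2 * Suc k, Cc) = successors (2 * Suc k + 1, Cd)"
proof -
  have "r \<in> successors (2 * Suc k, Cc) \<longleftrightarrow> r \<in> successors (2 * Suc k + 1, Cd)" for r
    by (cases r; cases "snd r"; simp add: successors_def valid_part_def; presburger)
  then show ?thesis by blast
qed

text \<open>The entry \<open>B2 Cd Cd = 4\<close> forces a drop of two levels, whence the removal
  from \<open>below k\<close>; for \<open>k = 0\<close> the removed part is the forbidden
  \<open>(1, Cd)\<close>, which is not in \<open>below 0\<close> anyway.\<close>

lemma successors_Cd:
  "successors (2 * Suc k + 1, Cd) =
     insert (2 * Suc k, Cc) (insert (2 * k + 1, Ca) (below k - {(2 * k + 1, Cd)}))"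
proof -
  have "r \<in> successors (2 * Suc k + 1, Cd) \<longleftrightarrow>
      r \<in> insert (2 * Suc k, Cc) (insert (2 * k + 1, Ca) (below k - {(2 * k + 1, Cd)}))" for r
    by (cases r; cases "snd r"; simp add: successors_def below_def valid_part_def; presburger)
  then show ?thesis by blast
qed

text \<open>The part coloured \<open>b\<close> is inserted first, so that the innermost set is the
  one of \<open>successors_Ca\<close>.\<close>

lemma below_Suc:
  "below (Suc k) = insert (2 * Suc k + 1, Cd) (insert (2 * Suc k, Cc)
     (insert (2 * k + 1, Ca) (insert (2 * Suc k, Cb) (below k))))"
proof -
  have "r \<in> below (Suc k) \<longleftrightarrow> r \<in> insert (2 * Suc k + 1, Cd) (insert (2 * Suc k, Cc)
     (insert (2 * k + 1, Ca) (insert (2 * Suc k, Cb) (below k))))" for r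
    by (cases r; cases "snd r"; simp add: below_def valid_part_def; presburger)
  then show ?thesis by blast
qed

lemma not_in_below:
  "(2 * Suc k + 1, Cd) \<notin> below k" "(2 * Suc k, Cc) \<notin> below k"
  "(2 * k + 1, Ca) \<notin> below k" "(2 * Suc k, Cb) \<notin> below k"
  by (auto simp: below_def)

section \<open>Weighted generating functions by first part\<close>

context
  fixes a c d :: "'a::field"
begin

fun colour_weight :: "colour \<Rightarrow> 'a" where
  "colour_weight Ca = a" | "colour_weight Cb = 1" | "colour_weight Cc = c" | "colour_weight Cd = d"

definition seq_weight :: "(nat \<times> colour) list \<Rightarrow> 'a" where
  "seq_weight xs = prod_list (map (\<lambda>p. colour_weight (snd p)) xs)"

definition head_gf :: "(nat \<times> colour) set \<Rightarrow> 'a fps" where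
  "head_gf H = Abs_fps (\<lambda>n. \<Sum>xs | valid_seq xs \<and> sum_list (map fst xs) = n \<and>
     (xs = [] \<or> hd xs \<in> H). seq_weight xs)"

lemma seq_weight_eq: "seq_weight xs = a ^ ncol Ca xs * c ^ ncol Cc xs * d ^ ncol Cd xs"
proof (induction xs)
  case Nil
  show ?case by (simp add: seq_weight_def ncol_def)
next
  case (Cons p xs)
  then show ?case
    by (cases "snd p") (simp_all add: seq_weight_def ncol_def algebra_simps)
qed

lemma head_gf_empty: "head_gf {} = 1"
proof (rule fps_ext)
  fix n
  have "{xs. valid_seq xs \<and> sum_list (map fst xs) = n \<and> (xs = [] \<or> hd xs \<in> {})}
      = (if n = 0 then {[]} else {})"
    by (auto simp: valid_seq_def)
  then show "head_gf {} $ n = 1 $ n"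
    by (simp add: head_gf_def seq_weight_def)
qed

text \<open>A valid sequence with first part \<open>p\<close> is \<open>p\<close> followed by a
  valid sequence that is empty or starts in \<open>successors p\<close>. All equations of the linear
  system come from this.\<close>

lemma head_gf_insert:
  assumes "valid_part p" "p \<notin> H"
  shows "head_gf (insert p H) =
    head_gf H + fps_const (colour_weight (snd p)) * fps_X ^ fst p * head_gf (successors p)"
proof (rule fps_ext)
  fix n
  let ?S = "\<lambda>H n. {xs. valid_seq xs \<and> sum_list (map fst xs) = n \<and> (xs = [] \<or> hd xs \<in> H)}"
  \<comment> \<open>Subtraction on \<open>nat\<close> truncates, so the case where \<open>p\<close>
    alone exceeds \<open>n\<close> is set apart.\<close>
  let ?T = "if n < fst p then {} else ?S (successors p) (n - fst p)"
  have fin: "finite (?S H n)" for H n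
    by (rule finite_subset[OF _ finite_valid_seq_sum[of n]]) auto
  have split: "?S (insert p H) n = ?S H n \<union> Cons p ` ?T"
  proof (intro equalityI subsetI)
    fix xs assume xs: "xs \<in> ?S (insert p H) n"
    show "xs \<in> ?S H n \<union> Cons p ` ?T"
    proof (cases "xs \<noteq> [] \<and> hd xs = p")
      case True
      then obtain ys where ys: "xs = p # ys" by (cases xs) auto
      moreover have "ys \<in> ?T"
        using xs ys by (cases ys) (auto simp: valid_seq_Cons successors_def)
      ultimately show ?thesis by blast
    next
      case False
      then show ?thesis using xs by auto
    qed
  next
    fix xs assume "xs \<in> ?S H n \<union> Cons p ` ?T"
    then show "xs \<in> ?S (insert p H) n"
      using assms by (auto simp: valid_seq_Cons successors_def split: if_splits)
  qed
  have "head_gf (insert p H) $ n = (\<Sum>xs\<in>?S H n. seq_weight xs) + (\<Sum>xs\<in>Cons p ` ?T. seq_weight xs)"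
    unfolding head_gf_def fps_nth_Abs_fps split
  proof (rule sum.union_disjoint)
    show "finite (?S H n)" by (rule fin)
    show "finite (Cons p ` ?T)" using fin[of "n - fst p" "successors p"] by simp
    have "p # ys \<notin> ?S H n" for ys using assms(2) by simp
    then show "?S H n \<inter> Cons p ` ?T = {}" by blast
  qed
  also have "(\<Sum>xs\<in>Cons p ` ?T. seq_weight xs) = (\<Sum>xs\<in>?T. colour_weight (snd p) * seq_weight xs)"
    by (subst sum.reindex) (auto simp: seq_weight_def)
  also have "\<dots> = (fps_const (colour_weight (snd p)) * fps_X ^ fst p * head_gf (successors p)) $ n"
    by (simp add: mult.assoc fps_X_power_mult_nth head_gf_def sum_distrib_left)
  finally show "head_gf (insert p H) $ n = (head_gf H +
      fps_const (colour_weight (snd p)) * fps_X ^ fst p * head_gf (successors p)) $ n"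
    by (simp add: head_gf_def)
qed

section \<open>The linear system and its elimination\<close>

text \<open>\<open>tail_gf_a k\<close> is \<open>P\<^sub>k\<close>, counting what may follow the level \<open>k + 1\<close> part coloured \<open>a\<close>;
  \<open>tail_gf_d k\<close> counts what may follow either of the level \<open>k\<close> parts coloured \<open>c\<close> and \<open>d\<close>.\<close>
definition below_gf :: "nat \<Rightarrow> 'a fps" where "below_gf k = head_gf (below k)"
definition tail_gf_a :: "nat \<Rightarrow> 'a fps" where "tail_gf_a k = head_gf (successors (2 * k + 1, Ca))"
definition tail_gf_d :: "nat \<Rightarrow> 'a fps" where "tail_gf_d k = head_gf (successors (2 * k + 1, Cd))"

lemma below_gf_0: "below_gf 0 = 1"
proof -
  have "below 0 = {}"
    by (auto simp: below_def valid_part_def elim!: offset.elims)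
  then show ?thesis by (simp add: below_gf_def head_gf_empty)
qed

lemma tail_gf_a_0: "tail_gf_a 0 = 1"
proof -
  have "successors (1, Ca) = {}"
    by (auto simp: successors_def valid_part_def)
  then show ?thesis by (simp add: tail_gf_a_def head_gf_empty)
qed

text \<open>The part \<open>2 * k + 2\<close> coloured \<open>b\<close> may be repeated, and what
  may follow it is again counted by \<open>tail_gf_a (Suc k)\<close>; this amounts to a geometric
  series in \<open>q ^ (2 * k + 2)\<close>.\<close>

lemma below_gf_eq: "below_gf k = (1 - fps_X ^ (2 * k + 2)) * tail_gf_a (Suc k)"
proof -
  have "tail_gf_a (Suc k) = head_gf (insert (2 * Suc k, Cb) (below k))"
    unfolding tail_gf_a_def successors_Ca ..
  also have "\<dots> = below_gf k + fps_X ^ (2 * k + 2) * tail_gf_a (Suc k)"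
    unfolding tail_gf_a_def below_gf_def successors_Cb[symmetric]
    by (subst head_gf_insert) (use not_in_below[of k] in \<open>simp_all add: valid_part_def\<close>)
  finally have "tail_gf_a (Suc k) = below_gf k + fps_X ^ (2 * k + 2) * tail_gf_a (Suc k)" .
  then show ?thesis by (simp add: algebra_simps)
qed

text \<open>The four parts of level \<open>k + 1\<close> are inserted one by one; those coloured
  \<open>c\<close> and \<open>d\<close> share their successors.\<close>

lemma below_gf_Suc:
  "below_gf (Suc k) = tail_gf_a (Suc k) + fps_const a * fps_X ^ (2 * k + 1) * tail_gf_a k
     + (fps_const c * fps_X ^ (2 * k + 2) + fps_const d * fps_X ^ (2 * k + 3)) * tail_gf_d (Suc k)"
proof -
  have "below_gf (Suc k) = tail_gf_a (Suc k) + fps_const a * fps_X ^ (2 * k + 1) * tail_gf_a k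
     + fps_const c * fps_X ^ (2 * Suc k) * tail_gf_d (Suc k) + fps_const d * fps_X ^ (2 * Suc k + 1) * tail_gf_d (Suc k)"
    unfolding below_gf_def below_Suc tail_gf_a_def tail_gf_d_def successors_Cc[symmetric] successors_Ca[of k]
    using not_in_below[of k]
    by (simp add: head_gf_insert valid_part_def successors_Cc[simplified])
  then show ?thesis by (simp add: algebra_simps numeral_3_eq_3)
qed

text \<open>Repetition of the part coloured \<open>c\<close> gives the factor on the left. The
  second term accounts for the part coloured \<open>d\<close> of level \<open>k\<close> that is
  removed from \<open>below k\<close>; for \<open>k = 0\<close> there is none.\<close>

lemma tail_gf_d_Suc:
  "(1 - fps_const c * fps_X ^ (2 * k + 2)) * tail_gf_d (Suc k)
     + (if k = 0 then 0 else fps_const d * fps_X ^ (2 * k + 1) * tail_gf_d k)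
   = below_gf k + fps_const a * fps_X ^ (2 * k + 1) * tail_gf_a k"
proof -
  let ?D = "if k = 0 then 0 else fps_const d * fps_X ^ (2 * k + 1) * tail_gf_d k"
  have "below_gf k = head_gf (below k - {(2 * k + 1, Cd)}) + ?D"
  proof (cases k)
    case 0
    have "(1, Cd) \<notin> below 0" by (simp add: below_def valid_part_def)
    then show ?thesis using 0 by (simp add: below_gf_def)
  next
    case (Suc j)
    have "(2 * k + 1, Cd) \<in> below k" using Suc by (simp add: below_def valid_part_def)
    then have "below k = insert (2 * k + 1, Cd) (below k - {(2 * k + 1, Cd)})" by blast
    then have "below_gf k = head_gf (insert (2 * k + 1, Cd) (below k - {(2 * k + 1, Cd)}))"
      unfolding below_gf_def by metis
    also have "\<dots> = head_gf (below k - {(2 * k + 1, Cd)}) + ?D"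
      using Suc by (subst head_gf_insert) (simp_all add: valid_part_def tail_gf_d_def)
    finally show ?thesis .
  qed
  moreover have "tail_gf_d (Suc k) = head_gf (below k - {(2 * k + 1, Cd)})
      + fps_const a * fps_X ^ (2 * k + 1) * tail_gf_a k + fps_const c * fps_X ^ (2 * Suc k) * tail_gf_d (Suc k)"
    unfolding tail_gf_d_def tail_gf_a_def successors_Cc[symmetric]
    using not_in_below[of k]
    by (subst successors_Cc, subst successors_Cd) (simp add: head_gf_insert valid_part_def successors_Cc[simplified])
  ultimately show ?thesis by (simp add: algebra_simps)
qed

text \<open>Both values of \<open>tail_gf_d\<close> are eliminated between
  \<open>below_gf_Suc\<close>, taken at \<open>k\<close> and \<open>k - 1\<close>, and
  \<open>tail_gf_d_Suc\<close>; then \<open>below_gf_eq\<close> removes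
  \<open>below_gf\<close>.\<close>

lemma tail_gf_a_recurrence:
  "(1 - fps_const c * fps_X ^ (2 * k + 2)) * (1 - fps_X ^ (2 * k + 4)) * tail_gf_a (k + 2) =
     (1 - fps_const c * fps_X ^ (4 * k + 4)) * tail_gf_a (k + 1)
     + (fps_const a * fps_X ^ (2 * k + 1) + fps_const d * fps_X ^ (2 * k + 3)
        + fps_const a * fps_const d * fps_X ^ (4 * k + 4)) * tail_gf_a k
     + (if k = 0 then 0 else fps_const a * fps_const d * fps_X ^ (4 * k + 2) * tail_gf_a (k - 1))"
proof -
  define a' c' d' z where "a' = fps_const a" "c' = fps_const c" "d' = fps_const d"
    "z = (fps_X :: 'a fps) ^ (2 * k + 1)"
  note defs = this
  define x where "x = (fps_X :: 'a fps)"
  define w where "w = (if k = 0 then 0 else fps_X ^ (2 * k - 1) * tail_gf_a (k - 1))"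
  define D where "D = (if k = 0 then 0 else d' * z * tail_gf_d k)"
  have xs: "fps_X ^ (2 * k + 2) = x * z" "fps_X ^ (2 * k + 3) = x^2 * z" "fps_X ^ (2 * k + 4) = x^3 * z"
     "fps_X ^ (4 * k + 4) = x^2 * z^2"
    by (simp_all add: x_def defs power_add power_mult eval_nat_numeral power_mult_distrib algebra_simps)
  have G1: "below_gf (Suc k) = (1 - x^3 * z) * tail_gf_a (k + 2)"
    using below_gf_eq[of "Suc k"] xs(3) by (simp add: add.commute eval_nat_numeral)
  have G0: "below_gf k = (1 - x * z) * tail_gf_a (k + 1)"
    using below_gf_eq[of k] xs by simp
  have e2: "below_gf (Suc k) = tail_gf_a (k + 1) + a' * z * tail_gf_a k + (c' * (x * z) + d' * (x^2 * z)) * tail_gf_d (Suc k)"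
    using below_gf_Suc[of k] xs by (simp add: defs)
  have e3: "(1 - c' * (x * z)) * tail_gf_d (Suc k) + D = below_gf k + a' * z * tail_gf_a k"
    using tail_gf_d_Suc[of k] unfolding xs(1) D_def defs .
  \<comment> \<open>The bracket on the left is \<open>q^2\<close> times the factor of
    \<open>tail_gf_d k\<close> in \<open>below_gf_Suc\<close> at \<open>k - 1\<close>, so
    \<open>tail_gf_d k\<close> drops out. For \<open>k = 0\<close> both sides vanish thanks to the
    defaults in \<open>D\<close> and \<open>w\<close>.\<close>
  have eD: "(c' * (x * z) + d' * (x^2 * z)) * D = d' * x^2 * z * (below_gf k - tail_gf_a k - a' * w)"
  proof (cases k)
    case 0
    then show ?thesis by (simp add: D_def w_def below_gf_0 tail_gf_a_0)
  next
    case (Suc j)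
    have zj: "z = x * fps_X ^ (2 * j + 2)"
      by (simp add: defs Suc x_def power2_eq_square)
    have "below_gf k - tail_gf_a k - a' * w = (c' * fps_X ^ (2 * j + 2) + d' * fps_X ^ (2 * j + 3)) * tail_gf_d k"
      using below_gf_Suc[of j] Suc by (simp add: w_def defs algebra_simps)
    moreover have "fps_X ^ (2 * j + 3) = z" by (simp add: defs Suc eval_nat_numeral)
    ultimately show ?thesis using Suc zj by (simp add: D_def) (simp add: algebra_simps power2_eq_square)
  qed
  have w: "(if k = 0 then 0 else fps_const a * fps_const d * fps_X ^ (4 * k + 2) * tail_gf_a (k - 1))
      = a' * d' * x^2 * z * w"
  proof (cases k)
    case (Suc j)
    have "fps_X ^ (4 * k + 2) = x^2 * z * fps_X ^ (2 * k - 1)"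
      unfolding defs x_def Suc power_add[symmetric] by (rule arg_cong[of _ _ "\<lambda>m. fps_X ^ m"]) simp
    then show ?thesis using Suc by (simp add: w_def defs)
  qed (simp add: w_def)
  \<comment> \<open>The factor \<open>1 - c' * (x * z)\<close> lets \<open>e3\<close> replace
    \<open>tail_gf_d (Suc k)\<close>.\<close>
  have "(1 - c' * (x * z)) * (below_gf (Suc k) - tail_gf_a (k + 1) - a' * z * tail_gf_a k)
      = (c' * (x * z) + d' * (x^2 * z)) * ((1 - c' * (x * z)) * tail_gf_d (Suc k))"
    unfolding e2 by (simp only: diff_diff_eq add_diff_cancel_left' mult.left_commute)
  also have "\<dots> = (c' * (x * z) + d' * (x^2 * z)) * (below_gf k + a' * z * tail_gf_a k)
      - (c' * (x * z) + d' * (x^2 * z)) * D"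
    unfolding e3[symmetric] by (simp only: ring_distribs add_diff_cancel_right')
  also have "\<dots> = (c' * (x * z) + d' * (x^2 * z)) * (below_gf k + a' * z * tail_gf_a k)
      - d' * x^2 * z * (below_gf k - tail_gf_a k - a' * w)"
    using eD by simp
  finally have elim: "(1 - c' * (x * z)) * (below_gf (Suc k) - tail_gf_a (k + 1) - a' * z * tail_gf_a k) = \<dots>" .
  have "(1 - c' * (x * z)) * (1 - x^3 * z) * tail_gf_a (k + 2)
      = (1 - c' * (x * z)) * (below_gf (Suc k) - tail_gf_a (k + 1) - a' * z * tail_gf_a k)
        + (1 - c' * (x * z)) * (tail_gf_a (k + 1) + a' * z * tail_gf_a k)"
    unfolding G1 by (simp add: algebra_simps)
  also have "\<dots> = (1 - c' * (x^2 * z^2)) * tail_gf_a (k + 1)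
      + (a' * z + d' * (x^2 * z) + a' * d' * (x^2 * z^2)) * tail_gf_a k + a' * d' * x^2 * z * w"
    unfolding elim G0 by (simp add: algebra_simps power2_eq_square)
  finally show ?thesis
    unfolding w xs unfolding defs .
qed

section \<open>The limit of the tails and the numbers \<open>A2\<close>\<close>

lemma tail_gf_a_tendsto:
  "tail_gf_a \<longlonglongrightarrow> Abs_fps (\<lambda>n. \<Sum>xs | valid_seq xs \<and> sum_list (map fst xs) = n. seq_weight xs)"
proof (rule tendsto_fpsI)
  fix n
  show "\<forall>\<^sub>F k in sequentially. tail_gf_a k $ n =
    Abs_fps (\<lambda>n. \<Sum>xs | valid_seq xs \<and> sum_list (map fst xs) = n. seq_weight xs) $ n"
    \<comment> \<open>The first part is at most \<open>n\<close>, hence at distance at least 4, the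
      largest entry of row \<open>a\<close>, from \<open>2 * k + 1\<close>.\<close>
    using eventually_ge_at_top[of "n + 3"]
  proof eventually_elim
    case (elim k)
    have "hd xs \<in> successors (2 * k + 1, Ca)"
      if "valid_seq xs" "sum_list (map fst xs) = n" "xs \<noteq> []" for xs
      using that elim
      by (cases xs; cases "snd (hd xs)") (auto simp: valid_seq_Cons successors_def)
    then show ?case unfolding tail_gf_a_def head_gf_def fps_nth_Abs_fps
      by (intro sum.cong) auto
  qed
qed

text \<open>Sequences are grouped by their three colour counts. Parts are positive, so no count
  exceeds \<open>n\<close> and the bounded sums lose nothing.\<close>

lemma sum_A2:
  "(\<Sum>k\<le>n. \<Sum>l\<le>n. \<Sum>m\<le>n. of_nat (A2 n k l m) * a ^ k * c ^ l * d ^ m)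
   = (\<Sum>xs | valid_seq xs \<and> sum_list (map fst xs) = n. seq_weight xs)"
proof -
  let ?S = "{xs. valid_seq xs \<and> sum_list (map fst xs) = n}"
  let ?f = "\<lambda>xs. (ncol Ca xs, ncol Cc xs, ncol Cd xs)"
  have "length xs \<le> sum_list (map fst xs)" if "valid_seq xs" for xs
    using that by (induction xs) (auto simp: valid_seq_Cons valid_part_def)
  moreover have "ncol e xs \<le> length xs" for e xs
    by (simp add: ncol_def)
  ultimately have "?f ` ?S \<subseteq> {..n} \<times> {..n} \<times> {..n}"
    by (auto intro: order_trans)
  then have "(\<Sum>xs\<in>?S. seq_weight xs) =
      (\<Sum>y\<in>{..n} \<times> {..n} \<times> {..n}. \<Sum>xs | xs \<in> ?S \<and> ?f xs = y. seq_weight xs)"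
    by (intro sum.group[symmetric] finite_valid_seq_sum) auto
  also have "\<dots> = (\<Sum>(k, l, m)\<in>{..n} \<times> {..n} \<times> {..n}. of_nat (A2 n k l m) * a ^ k * c ^ l * d ^ m)"
  proof (intro sum.cong refl, clarify)
    fix k l m
    have "(\<Sum>xs | xs \<in> ?S \<and> ?f xs = (k, l, m). seq_weight xs)
        = (\<Sum>xs | xs \<in> ?S \<and> ?f xs = (k, l, m). a ^ k * c ^ l * d ^ m)"
      by (intro sum.cong) (auto simp: seq_weight_eq)
    also have "\<dots> = of_nat (A2 n k l m) * a ^ k * c ^ l * d ^ m"
      by (simp add: A2_def conj_assoc mult.assoc)
    finally show "(\<Sum>xs | xs \<in> ?S \<and> ?f xs = (k, l, m). seq_weight xs) = \<dots>" .
  qed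
  finally show ?thesis by (simp add: sum.cartesian_product)
qed

section \<open>The hypergeometric coefficients and their limit\<close>

text \<open>The coefficient of \<open>x ^ (2 * n)\<close> in the basic hypergeometric factor of \<open>F_series\<close> below; its value
  comes from the two-term recurrence that the q-difference equation imposes once \<open>(-x; q\<^sup>2)\<^sub>\<infinity>\<close> is
  split off.\<close>
primrec chi :: "nat \<Rightarrow> 'a fps" where
  "chi 0 = 1"
| "chi (Suc n) = chi n * (1 - fps_const (- a) * fps_X ^ (1 + 4 * n)) * (1 - fps_const (- d) * fps_X ^ (3 + 4 * n))
     * inverse ((1 - fps_const 1 * fps_X ^ (4 + 4 * n)) * (1 - fps_const c * fps_X ^ (2 + 4 * n)))"

lemma chi_Suc:
  "chi (Suc n) * (1 - fps_const 1 * fps_X ^ (4 + 4 * n)) * (1 - fps_const c * fps_X ^ (2 + 4 * n))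
   = chi n * (1 - fps_const (- a) * fps_X ^ (1 + 4 * n)) * (1 - fps_const (- d) * fps_X ^ (3 + 4 * n))"
proof -
  let ?u = "(1 - fps_const 1 * fps_X ^ (4 + 4 * n)) * (1 - fps_const c * fps_X ^ (2 + 4 * n)) :: 'a fps"
  have "inverse ?u * ?u = 1"
    by (rule inverse_mult_eq_1) simp
  then show ?thesis unfolding chi.simps by (simp only: mult.assoc) simp
qed

lemma chi_tendsto: "chi \<longlonglongrightarrow> Abs_fps (\<lambda>n. chi n $ n)"
proof (rule tendsto_fps_stabilize)
  fix k n :: nat
  assume "n \<le> k"
  then have lt: "n < 4 + 4 * k" "n < 2 + 4 * k" "n < 1 + 4 * k" "n < 3 + 4 * k" by auto
  show "chi (Suc k) $ n = chi k $ n"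
    using arg_cong[OF chi_Suc[of k], of "\<lambda>F. F $ n"]
    by (simp only: lt mult_one_minus_X_power_nth)
qed

text \<open>The recursion \<open>chi_Suc\<close> telescopes to an identity between partial products,
  in which all factors converge.\<close>

lemma chi_limit:
  "Abs_fps (\<lambda>n. chi n $ n) * (qpoch 1 4 4 * qpoch c 2 4) = qpoch (- a) 1 4 * qpoch (- d) 3 4"
proof (rule LIMSEQ_unique)
  let ?p = "\<lambda>x r N. \<Prod>j<N. 1 - fps_const x * fps_X ^ (r + 4 * j) :: 'a fps"
  have eq: "chi N * (?p 1 4 N * ?p c 2 N) = ?p (- a) 1 N * ?p (- d) 3 N" for N
  proof (induction N)
    case (Suc N)
    have "chi (Suc N) * (?p 1 4 (Suc N) * ?p c 2 (Suc N))
        = (chi (Suc N) * (1 - fps_const 1 * fps_X ^ (4 + 4 * N)) * (1 - fps_const c * fps_X ^ (2 + 4 * N)))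
          * (?p 1 4 N * ?p c 2 N)"
      by (simp only: prod.lessThan_Suc mult_ac)
    also have "\<dots> = (chi N * (?p 1 4 N * ?p c 2 N))
        * (1 - fps_const (- a) * fps_X ^ (1 + 4 * N)) * (1 - fps_const (- d) * fps_X ^ (3 + 4 * N))"
      unfolding chi_Suc by (simp only: mult_ac)
    also have "\<dots> = ?p (- a) 1 (Suc N) * ?p (- d) 3 (Suc N)"
      unfolding Suc.IH by (simp only: prod.lessThan_Suc mult_ac)
    finally show ?case .
  qed simp
  show "(\<lambda>N. chi N * (?p 1 4 N * ?p c 2 N)) \<longlonglongrightarrow>
      Abs_fps (\<lambda>n. chi n $ n) * (qpoch 1 4 4 * qpoch c 2 4)"
    by (intro tendsto_fps_mult chi_tendsto qpoch_tendsto) simp_all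
  show "(\<lambda>N. chi N * (?p 1 4 N * ?p c 2 N)) \<longlonglongrightarrow> qpoch (- a) 1 4 * qpoch (- d) 3 4"
    unfolding eq by (intro tendsto_fps_mult qpoch_tendsto) simp_all
qed

section \<open>The q-difference equation and its solution\<close>

text \<open>The substitution of \<open>q^2 * x\<close> for \<open>x\<close>, where \<open>x\<close>
  is the outer and \<open>q\<close> the inner variable. As a composition it inherits
  multiplicativity from the library.\<close>

definition dilate :: "'a fps fps \<Rightarrow> 'a fps fps" where
  "dilate F = F oo (fps_const (fps_X ^ 2) * fps_X)"

lemma dilate_nth: "dilate F $ n = fps_X ^ (2 * n) * F $ n"
  by (simp add: dilate_def power_mult)

lemma dilate_mult: "dilate (F * H) = dilate F * dilate H"
  unfolding dilate_def by (rule fps_compose_mult_distrib) simp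

definition E_series :: "'a fps fps" where "E_series = Abs_fps euler"

definition Y_series :: "'a fps fps" where
  "Y_series = Abs_fps (\<lambda>n. if even n then chi (n div 2) else 0)"

lemma E_series_eq: "E_series = (1 + fps_X) * dilate E_series"
proof (rule fps_ext)
  fix n
  show "E_series $ n = ((1 + fps_X) * dilate E_series) $ n"
  proof (cases n)
    case (Suc j)
    show ?thesis
      using euler_Suc_eq[of j, where ?'a = 'a]
      by (simp add: Suc E_series_def dilate_nth distrib_right del: euler.simps)
  qed (simp add: E_series_def dilate_nth distrib_right)
qed

lemma dilate_E_series_eq:
  "dilate E_series = (1 + fps_const (fps_X ^ 2) * fps_X) * dilate (dilate E_series)"
proof -
  have "dilate (1 + fps_X) = 1 + fps_const (fps_X ^ 2) * fps_X"
    by (rule fps_ext) (auto simp: dilate_nth fps_X_nth)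
  then show ?thesis by (metis E_series_eq dilate_mult)
qed

text \<open>The coefficient of \<open>x ^ (2 * m + 2)\<close> is \<open>q^2\<close> times the
  difference of the two sides of \<open>chi_Suc\<close>; odd coefficients vanish, and the constant
  one is \<open>q^2 - (q^2 + c) + c\<close>.\<close>

lemma Y_series_eq:
  "fps_const (fps_X ^ 2) * ((1 - fps_X ^ 2) * Y_series)
     - (fps_const (fps_X ^ 2 + fps_const c)
        + fps_const (fps_const a * fps_X ^ 3 + fps_const d * fps_X ^ 5) * fps_X ^ 2) * dilate Y_series
     + (fps_const (fps_const c) - fps_const (fps_const a * fps_const d * fps_X ^ 6) * fps_X ^ 2)
        * dilate (dilate Y_series) = 0" (is "?L = 0")
proof (rule fps_ext)
  define u v w where "u = fps_X ^ 2 + fps_const c"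
    and "v = fps_const a * fps_X ^ 3 + fps_const d * fps_X ^ 5"
    and "w = fps_const a * fps_const d * (fps_X :: 'a fps) ^ 6"
  fix n :: nat
  have L: "?L = fps_const (fps_X ^ 2) * (Y_series - fps_X ^ 2 * Y_series)
      - (fps_const u * dilate Y_series + fps_const v * (fps_X ^ 2 * dilate Y_series))
      + (fps_const (fps_const c) * dilate (dilate Y_series)
         - fps_const w * (fps_X ^ 2 * dilate (dilate Y_series)))"
    unfolding u_def[symmetric] v_def[symmetric] w_def[symmetric] by (simp only: ring_distribs mult.assoc mult_1)
  consider "n = 0" | "odd n" | m where "n = 2 * m + 2"
  proof (cases "even n \<and> n \<noteq> 0")
    case True
    then obtain l where "n = 2 * l" "l \<noteq> 0" by auto
    then have "n = 2 * (l - 1) + 2" by simp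
    then show ?thesis using that(3) by blast
  qed (use that in blast)
  then show "?L $ n = 0 $ n"
  proof cases
    case 1
    then show ?thesis unfolding L by (simp add: fps_X_power_mult_nth dilate_nth u_def algebra_simps)
  next
    case 2
    then show ?thesis
      unfolding L by (simp add: fps_X_power_mult_nth dilate_nth Y_series_def)
  next
    case (3 m)
    define X Z x' x a' c' d' where "X = (fps_X :: 'a fps)" and "Z = X ^ (4 * m)"
      and "x' = chi (Suc m)" and "x = chi m"
      and "a' = fps_const a" and "c' = fps_const c" and "d' = fps_const d"
    note defs = this
    have "2 * n = 4 + 4 * m" using 3 by simp
    then have pow: "fps_X ^ (2 * n) = X ^ 4 * Z" "fps_X ^ (2 * (n - 2)) = Z"
      using 3 by (simp_all add: defs power_add eval_nat_numeral)
    have nth: "Y_series $ n = x'" "Y_series $ (n - 2) = x" "\<not> n < 2"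
      using 3 by (simp_all add: Y_series_def defs)
    have neg: "fps_const (- a) = - a'" "fps_const (- d) = - d'" "fps_const 1 = (1 :: 'a fps)"
      by (simp_all add: defs)
    have chi: "x' * (1 - X ^ 4 * Z) * (1 - c' * (X ^ 2 * Z)) = x * (1 + a' * (X * Z)) * (1 + d' * (X ^ 3 * Z))"
      using chi_Suc[of m] unfolding neg power_add defs(1)[symmetric] defs(2)[symmetric] defs(3,4)[symmetric]
        defs(6)[symmetric] by simp
    have "?L $ n = X^2 * (x' - x) - (u * (X ^ 4 * Z * x') + v * (Z * x))
        + (c' * (X ^ 4 * Z * (X ^ 4 * Z * x')) - w * (Z * (Z * x)))"
      unfolding L by (simp add: fps_X_power_mult_nth dilate_nth pow nth del: One_nat_def)
         (simp add: defs)
    also have "\<dots> = X^2 * (x' * (1 - X ^ 4 * Z) * (1 - c' * (X ^ 2 * Z))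
        - x * (1 + a' * (X * Z)) * (1 + d' * (X ^ 3 * Z)))"
      unfolding u_def v_def w_def defs(1)[symmetric] defs(5-7)[symmetric]
      by (simp add: algebra_simps eval_nat_numeral)
    finally show ?thesis unfolding chi by simp
  qed
qed

definition F_series :: "'a fps fps" where "F_series = E_series * Y_series"

text \<open>Every term contains the factor \<open>E(q^2 * x)\<close>: \<open>(1 - x) * E(x)\<close>
  is \<open>(1 - x^2) * E(q^2 * x)\<close>, and \<open>(1 + q^2 * x) * E(q^4 * x)\<close> is
  \<open>E(q^2 * x)\<close>. What remains is \<open>Y_series_eq\<close>.\<close>

lemma F_series_eq:
  "fps_const (fps_X ^ 2) * (F_series - fps_X * F_series)
     - (fps_const (fps_X ^ 2 + fps_const c)
        + fps_const (fps_const a * fps_X ^ 3 + fps_const d * fps_X ^ 5) * fps_X ^ 2) * dilate F_series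
     + (1 + fps_const (fps_X ^ 2) * fps_X)
        * (fps_const (fps_const c) - fps_const (fps_const a * fps_const d * fps_X ^ 6) * fps_X ^ 2)
        * dilate (dilate F_series) = 0" (is "?q * _ - ?A * _ + ?r * ?B * _ = 0")
proof -
  let ?E1 = "dilate E_series"
  have "F_series - fps_X * F_series = (1 - fps_X) * ((1 + fps_X) * ?E1) * Y_series"
    unfolding F_series_def E_series_eq[symmetric] by (simp add: algebra_simps)
  also have "\<dots> = ?E1 * ((1 - fps_X ^ 2) * Y_series)"
    by (simp add: algebra_simps power2_eq_square)
  finally have 1: "F_series - fps_X * F_series = ?E1 * ((1 - fps_X ^ 2) * Y_series)" .
  have 2: "dilate F_series = ?E1 * dilate Y_series"
    by (simp add: F_series_def dilate_mult)
  have "?r * ?B * dilate (dilate F_series) = (?r * dilate ?E1) * (?B * dilate (dilate Y_series))"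
    by (simp only: F_series_def dilate_mult mult_ac)
  then have 3: "?r * ?B * dilate (dilate F_series) = ?E1 * (?B * dilate (dilate Y_series))"
    unfolding dilate_E_series_eq[symmetric] .
  have "?q * (F_series - fps_X * F_series) - ?A * dilate F_series + ?r * ?B * dilate (dilate F_series)
     = ?E1 * (?q * ((1 - fps_X ^ 2) * Y_series) - ?A * dilate Y_series + ?B * dilate (dilate Y_series))"
    unfolding 3 unfolding 1 2 by (simp only: right_diff_distrib distrib_left mult_ac)
  then show ?thesis unfolding Y_series_eq by simp
qed

text \<open>The coefficient of \<open>x ^ (k + 2)\<close> in \<open>F_series_eq\<close>, divided by
  \<open>q^2\<close>.\<close>

lemma F_series_recurrence:
  "(1 - fps_const c * fps_X ^ (2 * k + 2)) * (1 - fps_X ^ (2 * k + 4)) * F_series $ (k + 2) =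
     (1 - fps_const c * fps_X ^ (4 * k + 4)) * F_series $ (k + 1)
     + (fps_const a * fps_X ^ (2 * k + 1) + fps_const d * fps_X ^ (2 * k + 3)
        + fps_const a * fps_const d * fps_X ^ (4 * k + 4)) * F_series $ k
     + (if k = 0 then 0 else fps_const a * fps_const d * fps_X ^ (4 * k + 2) * F_series $ (k - 1))"
proof -
  define u v w q cc where "u = fps_X ^ 2 + fps_const c"
    and "v = fps_const a * fps_X ^ 3 + fps_const d * fps_X ^ 5"
    and "w = fps_const a * fps_const d * (fps_X :: 'a fps) ^ 6"
    and "q = (fps_X :: 'a fps) ^ 2" and "cc = fps_const c"
  define F where "F = F_series"
  define F1 F2 where "F1 = dilate F" and "F2 = dilate F1"
  have "fps_const q * (F - fps_X * F) - (fps_const u + fps_const v * fps_X ^ 2) * F1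
     + (1 + fps_const q * fps_X) * (fps_const cc - fps_const w * fps_X ^ 2) * F2 = 0"
    using F_series_eq unfolding u_def v_def w_def q_def cc_def F1_def F2_def F_def .
  moreover have "fps_const q * (F - fps_X * F) - (fps_const u + fps_const v * fps_X ^ 2) * F1
     + (1 + fps_const q * fps_X) * (fps_const cc - fps_const w * fps_X ^ 2) * F2
    = fps_const q * (F - fps_X ^ 1 * F) - (fps_const u * F1 + fps_const v * (fps_X ^ 2 * F1))
      + (fps_const cc * F2 - fps_const w * (fps_X ^ 2 * F2)
         + (fps_const (q * cc) * (fps_X ^ 1 * F2) - fps_const (q * w) * (fps_X ^ 3 * F2)))"
    unfolding fps_const_mult[symmetric] by (simp add: algebra_simps eval_nat_numeral)
  ultimately have "(fps_const q * (F - fps_X ^ 1 * F) - (fps_const u * F1 + fps_const v * (fps_X ^ 2 * F1))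
      + (fps_const cc * F2 - fps_const w * (fps_X ^ 2 * F2)
         + (fps_const (q * cc) * (fps_X ^ 1 * F2) - fps_const (q * w) * (fps_X ^ 3 * F2)))) $ (k + 2) = 0"
    by simp
  then have "q * (F $ (k + 2) - F $ (k + 1)) - (u * F1 $ (k + 2) + v * F1 $ k)
      + (cc * F2 $ (k + 2) - w * F2 $ k
         + (q * cc * F2 $ (k + 1) - q * w * (if k = 0 then 0 else F2 $ (k - 1)))) = 0"
    unfolding fps_add_nth fps_sub_nth fps_mult_left_const_nth fps_X_power_mult_nth
    by (cases "k = 0") (simp_all add: numeral_2_eq_2 numeral_3_eq_3)
  note coeff = this
  define a' d' X Z where "a' = fps_const a" and "d' = fps_const d" and "X = (fps_X :: 'a fps)"
    and "Z = X ^ (2 * k)"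
  have ZZ: "X ^ (4 * k) = Z * Z"
    unfolding Z_def power_add[symmetric] by simp
  have F1: "F1 $ (k + 2) = X ^ 4 * Z * F $ (k + 2)" "F1 $ k = Z * F $ k"
    by (simp_all add: F1_def dilate_nth X_def Z_def power_add eval_nat_numeral)
  have F2: "F2 $ (k + 2) = X ^ 8 * Z * Z * F $ (k + 2)" "F2 $ k = Z * Z * F $ k"
     "F2 $ (k + 1) = X ^ 4 * Z * Z * F $ (k + 1)"
    by (simp_all add: F2_def F1_def dilate_nth X_def Z_def power_add eval_nat_numeral)
  \<comment> \<open>The shift by \<open>x ^ 3\<close> reaches index \<open>k - 1\<close>, which does
    not exist for \<open>k = 0\<close>.\<close>
  define g where "g = (if k = 0 then 0 else fps_X ^ (4 * k - 4) * F $ (k - 1))"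
  have g: "(if k = 0 then 0 else F2 $ (k - 1)) = g"
    unfolding g_def F2_def F1_def dilate_nth mult.assoc[symmetric] power_add[symmetric]
    by (simp add: diff_mult_distrib2)
  have g': "(if k = 0 then 0 else fps_const a * fps_const d * fps_X ^ (4 * k + 2) * F_series $ (k - 1))
      = a' * d' * X ^ 6 * g"
  proof (cases "k = 0")
    case False
    then have "4 * k + 2 = 6 + (4 * k - 4)" by simp
    then show ?thesis
      using False unfolding g_def a'_def d'_def X_def F_def by (simp only: power_add if_False mult_ac)
  qed (simp add: g_def)
  have xs: "fps_X ^ (2 * k + 2) = X ^ 2 * Z" "fps_X ^ (2 * k + 4) = X ^ 4 * Z"
     "fps_X ^ (4 * k + 4) = X ^ 4 * Z * Z" "fps_X ^ (2 * k + 1) = X * Z" "fps_X ^ (2 * k + 3) = X ^ 3 * Z"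
    unfolding X_def[symmetric] power_add ZZ by (simp_all add: Z_def)
  have "X ^ 2 * ((1 - cc * (X ^ 2 * Z)) * (1 - X ^ 4 * Z) * F $ (k + 2)
     - ((1 - cc * (X ^ 4 * Z * Z)) * F $ (k + 1)
        + (a' * (X * Z) + d' * (X ^ 3 * Z) + a' * d' * (X ^ 4 * Z * Z)) * F $ k + a' * d' * X ^ 6 * g))
     = q * (F $ (k + 2) - F $ (k + 1)) - (u * (X ^ 4 * Z * F $ (k + 2)) + v * (Z * F $ k))
       + (cc * (X ^ 8 * Z * Z * F $ (k + 2)) - w * (Z * Z * F $ k)
          + (q * cc * (X ^ 4 * Z * Z * F $ (k + 1)) - q * w * g))"
    unfolding u_def v_def w_def q_def X_def[symmetric] a'_def[symmetric] d'_def[symmetric] cc_def[symmetric]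
    by (simp add: algebra_simps eval_nat_numeral)
  also have "\<dots> = 0"
    using coeff unfolding F1 F2 g .
  finally have "(1 - cc * (X ^ 2 * Z)) * (1 - X ^ 4 * Z) * F $ (k + 2)
     = ((1 - cc * (X ^ 4 * Z * Z)) * F $ (k + 1)
        + (a' * (X * Z) + d' * (X ^ 3 * Z) + a' * d' * (X ^ 4 * Z * Z)) * F $ k + a' * d' * X ^ 6 * g)"
    by (simp add: X_def)
  then show ?thesis
    unfolding g' xs cc_def a'_def d'_def F_def .
qed

text \<open>Both sides satisfy the same recurrence with nonzero leading coefficient. Its fourth term
  is absent for \<open>k = 0\<close>, so the values at 0 and 1 determine the solution.\<close>

lemma tail_gf_a_eq_F_series: "tail_gf_a k = F_series $ k"
proof (induction k rule: less_induct)
  case (less k)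
  consider "k = 0" | "k = 1" | j where "k = j + 2"
    by (metis One_nat_def add_2_eq_Suc' not0_implies_Suc)
  then show ?case
  proof cases
    case 1
    then show ?thesis by (simp add: tail_gf_a_0 F_series_def E_series_def Y_series_def)
  next
    case 2
    have "F_series $ 1 = euler 1"
      by (simp add: F_series_def E_series_def Y_series_def fps_mult_nth)
    moreover have "(1 - fps_X ^ 2) * tail_gf_a 1 = 1"
      using below_gf_eq[of 0] below_gf_0 by (simp add: power2_eq_square)
    moreover have "(1 - fps_X ^ 2) * euler 1 = (1 :: 'a fps)"
      using euler_Suc_eq[of 0, where ?'a = 'a]
      by (simp add: left_diff_distrib diff_eq_eq power2_eq_square mult.assoc add.commute del: euler.simps(2))
    moreover have "1 - fps_X ^ 2 \<noteq> (0 :: 'a fps)"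
      using one_minus_X_power_nonzero[of 2 1] by simp
    ultimately show ?thesis using 2 by (metis mult_left_cancel)
  next
    case (3 j)
    have "tail_gf_a (j + 1) = F_series $ (j + 1)" "tail_gf_a j = F_series $ j"
       "j \<noteq> 0 \<Longrightarrow> tail_gf_a (j - 1) = F_series $ (j - 1)"
      using less 3 by auto
    then have "(1 - fps_const c * fps_X ^ (2 * j + 2)) * (1 - fps_X ^ (2 * j + 4)) * tail_gf_a (j + 2) =
       (1 - fps_const c * fps_X ^ (2 * j + 2)) * (1 - fps_X ^ (2 * j + 4)) * F_series $ (j + 2)"
      unfolding tail_gf_a_recurrence F_series_recurrence by (cases "j = 0") simp_all
    moreover have "(1 - fps_const c * fps_X ^ (2 * j + 2)) * (1 - fps_X ^ (2 * j + 4)) \<noteq> (0 :: 'a fps)"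
      using one_minus_X_power_nonzero[of "2 * j + 2" c] one_minus_X_power_nonzero[of "2 * j + 4" "1 :: 'a"]
      by simp
    ultimately show ?thesis using 3 by simp
  qed
qed

section \<open>Passage to the limit and the product formula\<close>

text \<open>The factor \<open>1 + x\<close> of \<open>E(x)\<close> is moved to
  \<open>Y_series\<close>, whose gaps at odd exponents it fills. The exponent
  \<open>2 * 1 * j\<close> keeps the shape of the terms of \<open>euler_sum 1\<close>.\<close>

lemma F_series_nth: "F_series $ k = (\<Sum>j\<le>k. (fps_X ^ (2 * 1 * j) * euler j) * chi ((k - j) div 2))"
proof -
  have "F_series = dilate E_series * (Y_series + fps_X * Y_series)"
    unfolding F_series_def by (subst E_series_eq) (simp add: algebra_simps)
  moreover have "(Y_series + fps_X * Y_series) $ n = chi (n div 2)" for n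
    by (cases n) (auto simp: Y_series_def elim!: evenE oddE)
  ultimately show ?thesis
    by (simp only: fps_mult_nth[of "dilate E_series"] dilate_nth atLeast0AtMost mult_1_right)
       (simp only: E_series_def fps_nth_Abs_fps)
qed

lemma tail_gf_a_limit: "tail_gf_a \<longlonglongrightarrow> qpoch (- 1) 2 2 * Abs_fps (\<lambda>n. chi n $ n)"
proof -
  have "filterlim (\<lambda>n::nat. n div 2) sequentially sequentially"
    unfolding filterlim_at_top eventually_at_top_linorder
    by (metis div_le_mono nonzero_mult_div_cancel_left zero_neq_numeral)
  from filterlim_compose[OF chi_tendsto this]
  have "(\<lambda>n. chi (n div 2)) \<longlonglongrightarrow> Abs_fps (\<lambda>n. chi n $ n)" .
  then have "(\<lambda>k. \<Sum>j\<le>k. (fps_X ^ (2 * 1 * j) * euler j) * chi ((k - j) div 2))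
      \<longlonglongrightarrow> euler_sum 1 * Abs_fps (\<lambda>n. chi n $ n)"
    unfolding euler_sum_def by (intro tendsto_fps_convolution euler_term_nth) simp_all
  moreover have "tail_gf_a = (\<lambda>k. \<Sum>j\<le>k. (fps_X ^ (2 * 1 * j) * euler j) * chi ((k - j) div 2))"
    by (rule ext) (simp only: tail_gf_a_eq_F_series F_series_nth)
  ultimately show ?thesis unfolding euler_sum_1 by simp
qed

text \<open>By \<open>qpoch_uminus_mult\<close>,
  \<open>(-q^2; q^2)_inf * (q^2; q^2)_inf = (q^4; q^4)_inf\<close>, which cancels that factor in the
  denominator of the limit of \<open>chi\<close>.\<close>

lemma A2_gf:
  "Abs_fps (\<lambda>n. \<Sum>k\<le>n. \<Sum>l\<le>n. \<Sum>m\<le>n. of_nat (A2 n k l m) * a ^ k * c ^ l * d ^ m)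
     = qpoch (- a) 1 4 * qpoch (- d) 3 4 / (qpoch 1 2 2 * qpoch c 2 4)" (is "?A = _")
proof -
  let ?chi = "Abs_fps (\<lambda>n. chi n $ n)"
  have "?A = qpoch (- 1) 2 2 * ?chi"
    unfolding sum_A2 by (rule LIMSEQ_unique[OF tail_gf_a_tendsto tail_gf_a_limit])
  then have "?A * (qpoch 1 2 2 * qpoch c 2 4) = ?chi * ((qpoch (- 1) 2 2 * qpoch 1 2 2) * qpoch c 2 4)"
    by (simp only: mult_ac)
  also have "\<dots> = qpoch (- a) 1 4 * qpoch (- d) 3 4"
    using qpoch_uminus_mult[of 2 2 "1 :: 'a"] chi_limit by simp
  finally have prod: "?A * (qpoch 1 2 2 * qpoch c 2 4) = qpoch (- a) 1 4 * qpoch (- d) 3 4" .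
  have "qpoch 1 2 2 * qpoch c 2 4 \<noteq> 0" by (simp add: qpoch_nonzero)
  then show ?thesis unfolding prod[symmetric] by (rule nonzero_mult_div_cancel_right[symmetric])
qed

end

text \<open>The numerator is \<open>(-q; q^2)_inf\<close> by dissection. Multiplied by
  \<open>(q; q)_inf = (q; q^2)_inf * (q^2; q^2)_inf\<close> it gives the denominator, as
  \<open>(-q; q^2)_inf * (q; q^2)_inf = (q^2; q^4)_inf\<close>.\<close>

lemma qpoch_specialization:
  "qpoch (- 1) 1 4 * qpoch (- 1) 3 4 / (qpoch 1 2 2 * qpoch 1 2 4) = 1 / (qpoch 1 1 1 :: 'a::field fps)"
proof -
  let ?n = "qpoch (- 1) 1 4 * qpoch (- 1) 3 4 :: 'a fps"
  let ?d = "qpoch 1 2 2 * qpoch 1 2 4 :: 'a fps"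
  have "?n * qpoch 1 1 1 = (qpoch (- 1) 1 2 * qpoch 1 1 2) * qpoch 1 2 2"
    using qpoch_dissect[of 1 2 "- 1 :: 'a"] qpoch_dissect[of 1 1 "1 :: 'a"]
    by (simp add: mult_ac del: One_nat_def)
  also have "\<dots> = ?d"
    using qpoch_uminus_mult[of 1 2 "1 :: 'a"] by (simp add: mult_ac del: One_nat_def)
  finally have d: "?d = ?n * qpoch 1 1 1" ..
  have "?n \<noteq> 0" by (simp add: qpoch_nonzero)
  then show ?thesis unfolding d by (metis div_mult_mult1 mult.right_neutral)
qed

theorem theorem2p6:
  fixes a c d :: "'a::field"
  shows "(Abs_fps (\<lambda>n. \<Sum>k\<le>n. \<Sum>l\<le>n. \<Sum>m\<le>n.
             of_nat (A2 n k l m) * a ^ k * c ^ l * d ^ m)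
         = qpoch (- a) 1 4 * qpoch (- d) 3 4 / (qpoch 1 2 2 * qpoch c 2 4))
       \<and> (Abs_fps (\<lambda>n. of_nat (\<Sum>k\<le>n. \<Sum>l\<le>n. \<Sum>m\<le>n. A2 n k l m) :: 'a)
         = 1 / qpoch 1 1 1)"
proof
  show "Abs_fps (\<lambda>n. of_nat (\<Sum>k\<le>n. \<Sum>l\<le>n. \<Sum>m\<le>n. A2 n k l m) :: 'a) = 1 / qpoch 1 1 1"
    using A2_gf[of "1 :: 'a" 1 1] unfolding qpoch_specialization by simp
qed (rule A2_gf)

end
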